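(* Let $$J=\begin{pmatrix} b_0&a_0&0&0&\ldots\\ a_0&b_1&a_1&0&\ldots\\ 0&a_1&b_2&a_2&\ldots\\ \vdots&\vdots&\vdots&\vdots&\ddots\end{pmatrix}$$ be a complex Jacobi matrix, where $a_k,b_k\in\mathbb{C}$ and $a_k\neq 0$ for all $k\in\mathbb{Z}_+$. Suppose that there is $M>0$ such that $|a_k|\le M$ and $|b_k|\le M$ for all $k\in\mathbb{Z}_+$. Let $S:\mathbb{P}\to\mathbb{C}$ be the linear functional associated to $J$. Then there exists a (non-negative) measure $\mu$ on $\mathfrak{B}(\mathbb{C})$ with compact support such that $$S(p)=\int_{\mathbb{C}}p(\lambda)\,d\mu(\lambda),\qquad p\in\mathbb{P}.$$
   Context: $\mathbb{Z}_+$ is the set of non-negative integers, $\mathbb{P}$ is the set of all complex polynomials, and $\mathfrak{B}(\mathbb{C})$ is the set of all Borel subsets of $\mathbb{C}$. With the complex Jacobi matrix $J$ one associates the system of polynomials $\{p_n(\lambda)\}_{n=0}^\infty$ defined by $p_0(\lambda)=1$ and $$a_{n-1}p_{n-1}(\lambda)+b_np_n(\lambda)+a_np_{n+1}(\lambda)=\lambda p_n(\lambda),\qquad n\in\mathbb{Z}_+,$$ where $a_{-1}:=0$, $p_{-1}(\lambda):=0$. (Thus $\deg p_n=n$.) The spectral function $\sigma(u,v)$, $u,v\in\mathbb{P}$, is the functional, linear in both arguments (complex bilinear, no conjugation), determined by $\sigma(p_n,p_m)=\delta_{n,m}$ for all $n,m\in\mathbb{Z}_+$. The linear functional $S$ associated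 to $J$ is $S(u)=\sigma(u,1)$, $u\in\mathbb{P}$. *)

theory Defs
  imports "HOL-Analysis.Analysis" "HOL-Computational_Algebra.Polynomial"
begin

definition jacobi_matrix :: "(nat \<Rightarrow> complex) \<Rightarrow> (nat \<Rightarrow> complex) \<Rightarrow> nat \<Rightarrow> nat \<Rightarrow> complex" where
  "jacobi_matrix a b i j =
     (if j = i then b i else if j = Suc i then a i else if i = Suc j then a j else 0)"

(* The three-term recurrence solved for its leading term p (n + 1); the next two lemmas
   recover the recurrence itself. *)
fun jacobi_poly :: "(nat \<Rightarrow> nat \<Rightarrow> complex) \<Rightarrow> nat \<Rightarrow> complex poly" where
  "jacobi_poly J 0 = 1"
| "jacobi_poly J (Suc 0) = smult (1 / J 0 1) [:- J 0 0, 1:]"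
| "jacobi_poly J (Suc (Suc n)) =
     smult (1 / J (Suc n) (Suc (Suc n)))
       ([:- J (Suc n) (Suc n), 1:] * jacobi_poly J (Suc n) - smult (J (Suc n) n) (jacobi_poly J n))"

lemma jacobi_poly_recurrence_0:
  assumes "a 0 \<noteq> 0"
  shows "b 0 * poly (jacobi_poly (jacobi_matrix a b) 0) x
       + a 0 * poly (jacobi_poly (jacobi_matrix a b) 1) x
       = x * poly (jacobi_poly (jacobi_matrix a b) 0) x"
  using assms by (simp add: jacobi_matrix_def field_simps)

lemma jacobi_poly_recurrence_Suc:
  assumes "a (Suc n) \<noteq> 0"
  shows "a n * poly (jacobi_poly (jacobi_matrix a b) n) x
       + b (Suc n) * poly (jacobi_poly (jacobi_matrix a b) (Suc n)) x
       + a (Suc n) * poly (jacobi_poly (jacobi_matrix a b) (Suc (Suc n))) x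
       = x * poly (jacobi_poly (jacobi_matrix a b) (Suc n)) x"
  using assms by (simp add: jacobi_matrix_def algebra_simps)

lemma degree_jacobi_poly:
  assumes "\<And>n. J n (Suc n) \<noteq> 0"
  shows "degree (jacobi_poly J n) = n"
  using assms
proof (induction J n rule: jacobi_poly.induct)
  case (3 J n)
  have nz: "jacobi_poly J (Suc n) \<noteq> 0" using 3 by (metis degree_0 nat.distinct(1))
  have d: "degree ([:- J (Suc n) (Suc n), 1:] * jacobi_poly J (Suc n)) = Suc (Suc n)"
    using 3 nz by (subst degree_mult_eq) auto
  have "degree (smult (J (Suc n) n) (jacobi_poly J n)) < Suc (Suc n)"
    using 3 degree_smult_le[of "J (Suc n) n" "jacobi_poly J n"] by auto
  then have "degree ([:- J (Suc n) (Suc n), 1:] * jacobi_poly J (Suc n)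
      - smult (J (Suc n) n) (jacobi_poly J n)) = Suc (Suc n)"
    using d 
    using degree_add_eq_left[of "- smult (J (Suc n) n) (jacobi_poly J n)"] by simp
  then show ?case using 3(3)[of "Suc n"] by (simp del: mult_pCons_left)
qed auto

definition is_spectral_function ::
  "(nat \<Rightarrow> nat \<Rightarrow> complex) \<Rightarrow> (complex poly \<Rightarrow> complex poly \<Rightarrow> complex) \<Rightarrow> bool" where
  "is_spectral_function J \<sigma> \<longleftrightarrow>
     (\<forall>v. Vector_Spaces.linear smult (*) (\<lambda>u. \<sigma> u v)) \<and>
     (\<forall>u. Vector_Spaces.linear smult (*) (\<lambda>v. \<sigma> u v)) \<and>
     (\<forall>n m. \<sigma> (jacobi_poly J n) (jacobi_poly J m) = (if n = m then 1 else 0))"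

definition spectral_function ::
  "(nat \<Rightarrow> nat \<Rightarrow> complex) \<Rightarrow> complex poly \<Rightarrow> complex poly \<Rightarrow> complex" where
  "spectral_function J = (THE \<sigma>. is_spectral_function J \<sigma>)"

lemma vector_space_complex_poly:
  "vector_space (smult :: complex \<Rightarrow> complex poly \<Rightarrow> complex poly)"
  by unfold_locales (auto simp: smult_add_left smult_add_right)

lemma ex1_spectral_function:
  assumes J: "\<And>n. J n (Suc n) \<noteq> 0"
  shows "\<exists>!\<sigma>. is_spectral_function J \<sigma>"
proof -
  interpret vs: vector_space "smult :: complex \<Rightarrow> complex poly \<Rightarrow> complex poly"
    by (rule vector_space_complex_poly)
  interpret vc: vector_space "(*) :: complex \<Rightarrow> complex \<Rightarrow> complex"
    by unfold_locales (auto simp: algebra_simps)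
  interpret vp: vector_space_pair "smult :: complex \<Rightarrow> complex poly \<Rightarrow> complex poly"
    "(*) :: complex \<Rightarrow> complex \<Rightarrow> complex" ..
  define p where "p = jacobi_poly J"
  have deg: "degree (p n) = n" for n
    unfolding p_def using J by (rule degree_jacobi_poly)
  have nz: "p n \<noteq> 0" for n
  proof (cases n)
    case (Suc m) then show ?thesis using deg[of n] by auto
  qed (simp add: p_def)
  have lc: "coeff (p n) n \<noteq> 0" for n
    using nz[of n] deg[of n] by (metis leading_coeff_0_iff)
  have inj: "inj p" by (rule injI) (metis deg)
  have below: "u \<in> vs.span (p ` {..<n})" if "\<forall>k\<ge>n. coeff u k = 0" for u n
    using that
  proof (induction n arbitrary: u)
    case 0
    then have "u = 0" by (simp add: poly_eq_iff)
    then show ?case by (simp add: vs.span_zero)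
  next
    case (Suc n)
    define c where "c = coeff u n / coeff (p n) n"
    have "\<forall>k\<ge>n. coeff (u - smult c (p n)) k = 0"
    proof (intro allI impI)
      fix k assume "k \<ge> n"
      show "coeff (u - smult c (p n)) k = 0"
      proof (cases "k = n")
        case True then show ?thesis using lc[of n] by (simp add: c_def)
      next
        case False
        then have "k > n" using \<open>k \<ge> n\<close> by simp
        then show ?thesis using Suc.prems deg[of n] by (simp add: coeff_eq_0)
      qed
    qed
    then have "u - smult c (p n) \<in> vs.span (p ` {..<n})" by (rule Suc.IH)
    then have "u - smult c (p n) \<in> vs.span (p ` {..<Suc n})"
      by (rule rev_subsetD) (rule vs.span_mono, auto)
    moreover have "smult c (p n) \<in> vs.span (p ` {..<Suc n})"
      by (intro vs.span_scale vs.span_base) auto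
    ultimately show ?case using vs.span_add by fastforce
  qed
  have span: "vs.span (range p) = UNIV"
  proof (intro equalityI subsetI)
    fix u :: "complex poly"
    have "u \<in> vs.span (p ` {..<Suc (degree u)})"
      by (rule below) (simp add: coeff_eq_0)
    then show "u \<in> vs.span (range p)"
      by (rule rev_subsetD) (rule vs.span_mono, auto)
  qed simp
  have coeff0: "coeff u k = 0" if "u \<in> vs.span (p ` {..<n})" "k \<ge> n" for u n k
    using that
  proof (induction rule: vs.span_induct_alt)
    case (step c x y)
    then show ?case using deg by (auto simp: coeff_eq_0)
  qed simp
  have indep_n: "vs.independent (p ` {..<n})" for n
  proof (induction n)
    case 0 then show ?case by (simp add: vs.independent_empty)
  next
    case (Suc n)
    have "p n \<notin> vs.span (p ` {..<n})" using coeff0[of "p n" n n] lc by auto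
    then have "vs.independent (insert (p n) (p ` {..<n}))"
      using Suc by (rule vs.independent_insertI)
    then show ?case by (simp add: lessThan_Suc)
  qed
  have indep: "vs.independent (range p)"
  proof (rule ccontr)
    assume "\<not> vs.independent (range p)"
    then obtain t where t: "finite t" "t \<subseteq> range p" "vs.dependent t"
      unfolding vs.dependent_explicit by blast
    then obtain F where F: "finite F" "t = p ` F" by (meson finite_subset_image)
    then obtain N where "F \<subseteq> {..<N}" using finite_nat_iff_bounded by blast
    then have "t \<subseteq> p ` {..<N}" using F by auto
    then show False using indep_n t(3) vs.dependent_mono by blast
  qed
  define c where "c n = vp.construct (range p) (\<lambda>x. if x = p n then 1 else 0)" for n
  have c_lin: "Vector_Spaces.linear smult (*) (c n)" for n
    unfolding c_def by (rule vp.linear_construct[OF indep])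
  have c_p: "c n (p m) = (if n = m then 1 else 0)" for n m
    unfolding c_def using vp.construct_basis[OF indep, of "p m"] inj
    by (auto simp: inj_eq)
  define \<sigma> where "\<sigma> u v = vp.construct (range p) (\<lambda>x. c (inv p x) v) u" for u v
  have s_lin: "Vector_Spaces.linear smult (*) (\<lambda>u. \<sigma> u v)" for v
    unfolding \<sigma>_def using vp.linear_construct[OF indep] .
  have s_p: "\<sigma> (p n) v = c n v" for n v
    unfolding \<sigma>_def using vp.construct_basis[OF indep, of "p n"] inj by simp
  have s_lin2: "Vector_Spaces.linear smult (*) (\<lambda>v. \<sigma> u v)" for u
  proof -
    have "u \<in> vs.span (range p)" using span by simp
    then show ?thesis
    proof (induction rule: vs.span_induct_alt)
      case base
      show ?case using vp.linear_0[OF s_lin] by (simp add: vp.linear_zero)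
    next
      case (step k x y)
      then obtain n where x: "x = p n" by auto
      have "\<sigma> (smult k x + y) = (\<lambda>v. k * c n v + \<sigma> y v)"
        using vp.linear_add[OF s_lin] vp.linear_scale[OF s_lin] x s_p by fastforce
      then show ?case
        using vp.linear_compose_add[OF vp.linear_compose_scale_right[OF c_lin] step.IH] by simp
    qed
  qed
  show ?thesis
  proof (rule ex1I)
    show "is_spectral_function J \<sigma>"
      unfolding is_spectral_function_def using s_lin s_lin2 s_p c_p by (simp add: p_def)
  next
    fix \<tau> assume "is_spectral_function J \<tau>"
    then have t1: "Vector_Spaces.linear smult (*) (\<lambda>u. \<tau> u v)"
      and t2: "Vector_Spaces.linear smult (*) (\<lambda>v. \<tau> u v)"
      and t3: "\<tau> (p n) (p m) = (if n = m then 1 else 0)" for u v n m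
      by (auto simp: is_spectral_function_def p_def)
    have eq1: "\<tau> (p n) v = \<sigma> (p n) v" for n v
      by (rule vp.linear_eq_on[OF t2 s_lin2, of v "range p"]) (auto simp: span t3 s_p c_p)
    have "\<tau> u v = \<sigma> u v" for u v
      by (rule vp.linear_eq_on[OF t1 s_lin, of u "range p"]) (auto simp: span eq1)
    then show "\<tau> = \<sigma>" by blast
  qed
qed

lemma is_spectral_function_spectral_function:
  assumes "\<And>n. J n (Suc n) \<noteq> 0"
  shows "is_spectral_function J (spectral_function J)"
  unfolding spectral_function_def using theI'[of "is_spectral_function J"] ex1_spectral_function[of J] assms by blast

definition spectral_functional :: "(nat \<Rightarrow> nat \<Rightarrow> complex) \<Rightarrow> complex poly \<Rightarrow> complex" where
  "spectral_functional J u = spectral_function J u 1"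

definition measure_support :: "'a::topological_space measure \<Rightarrow> 'a set" where
  "measure_support \<mu> = {x. \<forall>U. open U \<and> x \<in> U \<longrightarrow> emeasure \<mu> U \<noteq> 0}"

lemma emeasure_Compl_measure_support:
  fixes \<mu> :: "'a::second_countable_topology measure"
  assumes "sets \<mu> = sets borel"
  shows "emeasure \<mu> (- measure_support \<mu>) = 0"
proof -
  define F where "F = {U. open U \<and> emeasure \<mu> U = 0}"
  obtain F' where F': "F' \<subseteq> F" "countable F'" "\<Union>F' = \<Union>F"
    using Lindelof[of F] by (auto simp: F_def)
  have "(\<Union>U\<in>F'. U) \<in> null_sets \<mu>"
    using F' assms by (intro null_sets_UN') (auto simp: F_def null_sets_def)
  then have "emeasure \<mu> (\<Union>F') = 0" by auto
  moreover have "- measure_support \<mu> = \<Union>F"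
    by (auto simp: measure_support_def F_def)
  ultimately show ?thesis using F'(3) by simp
qed

lemma compact_measure_support_iff:
  fixes \<mu> :: "'a::{t2_space, second_countable_topology} measure"
  assumes "sets \<mu> = sets borel"
  shows "compact (measure_support \<mu>) \<longleftrightarrow> (\<exists>K. compact K \<and> emeasure \<mu> (- K) = 0)"
proof
  assume "compact (measure_support \<mu>)"
  then show "\<exists>K. compact K \<and> emeasure \<mu> (- K) = 0"
    using emeasure_Compl_measure_support[OF assms] by blast
next
  assume "\<exists>K. compact K \<and> emeasure \<mu> (- K) = 0"
  then obtain K where K: "compact K" "emeasure \<mu> (- K) = 0" by blast
  then have "measure_support \<mu> \<subseteq> K"
    using compact_imp_closed[OF K(1)] by (fastforce simp: measure_support_def)
  moreover have "open (- measure_support \<mu>)"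
    unfolding open_subopen[of "- measure_support \<mu>"] by (fastforce simp: measure_support_def)
  ultimately show "compact (measure_support \<mu>)"
    using K(1) compact_Int_closed[of K "measure_support \<mu>"] by (simp add: closed_def Int_absorb1)
qed

end

theory Submission
  imports Defs
begin

text \<open>
  Since \<open>S\<close> maps the orthonormal polynomials to \<open>0\<close> or \<open>1\<close> and multiplication by \<open>\<lambda>\<close> acts on them
  by the recurrence, induction gives \<open>|S(\<lambda>\<^sup>n p\<^sub>k)| \<le> (3M)\<^sup>n\<close>, in particular \<open>|s\<^sub>n| \<le> (3M)\<^sup>n\<close> for the
  moments \<open>s\<^sub>n = S(\<lambda>\<^sup>n)\<close>.  On the circle of radius \<open>R = 9M\<close> the measure with density
  \<open>(1 + 2 Re \<Sum>\<^sub>n\<^sub>\<ge>\<^sub>1 s\<^sub>n R\<^sup>-\<^sup>n e\<^sup>-\<^sup>i\<^sup>n\<^sup>t) / 2\<pi>\<close> has these moments, and it is non-negative because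
  the series is bounded by \<open>\<Sum>\<^sub>n\<^sub>\<ge>\<^sub>1 3\<^sup>-\<^sup>n = 1/2\<close>.
\<close>

section \<open>The recurrence and the growth of the moments\<close>

text \<open>A linear functional needs the recurrence as an identity in the polynomial ring; it
  follows from the pointwise one because a complex polynomial is determined by its values.\<close>

lemma jacobi_poly_times_x:
  fixes a b :: "nat \<Rightarrow> complex"
  assumes a: "\<And>k. a k \<noteq> 0"
  defines "p \<equiv> jacobi_poly (jacobi_matrix a b)"
  shows "[:0, 1:] * p 0 = smult (b 0) (p 0) + smult (a 0) (p 1)"
    and "[:0, 1:] * p (Suc n) =
      smult (a n) (p n) + smult (b (Suc n)) (p (Suc n)) + smult (a (Suc n)) (p (Suc (Suc n)))"
proof -
  show "[:0, 1:] * p 0 = smult (b 0) (p 0) + smult (a 0) (p 1)"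
    unfolding poly_eq_poly_eq_iff[symmetric] p_def
    using jacobi_poly_recurrence_0[of a b] a by (auto simp del: jacobi_poly.simps)
  show "[:0, 1:] * p (Suc n) =
      smult (a n) (p n) + smult (b (Suc n)) (p (Suc n)) + smult (a (Suc n)) (p (Suc (Suc n)))"
    unfolding poly_eq_poly_eq_iff[symmetric] p_def
    using jacobi_poly_recurrence_Suc[of a n b] a by (auto simp del: jacobi_poly.simps)
qed

lemma spectral_functional_linear:
  assumes "\<And>n. J n (Suc n) \<noteq> 0"
  shows "Vector_Spaces.linear smult (*) (spectral_functional J)"
  using is_spectral_function_spectral_function[of J] assms
  by (simp add: is_spectral_function_def spectral_functional_def[abs_def])

lemma spectral_functional_jacobi_poly:
  assumes "\<And>n. J n (Suc n) \<noteq> 0"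
  shows "spectral_functional J (jacobi_poly J n) = (if n = 0 then 1 else 0)"
proof -
  have "spectral_function J (jacobi_poly J n) (jacobi_poly J 0) = (if n = 0 then 1 else 0)"
    using is_spectral_function_spectral_function[of J] assms
    unfolding is_spectral_function_def by blast
  then show ?thesis by (simp add: spectral_functional_def)
qed

text \<open>Induction on \<open>n\<close> with \<open>k\<close> arbitrary, because one factor
  \<open>[:0, 1:]\<close> moves index \<open>k\<close> to its neighbours. At most three terms arise,
  each with a coefficient bounded by \<open>M\<close>, so each factor costs at most
  \<open>3 * M\<close>.\<close>

lemma norm_spectral_functional_le:
  assumes a: "\<And>k. a k \<noteq> 0" and aM: "\<And>k. norm (a k) \<le> M" and bM: "\<And>k. norm (b k) \<le> M"
  defines "J \<equiv> jacobi_matrix a b"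
  shows "norm (spectral_functional J ([:0, 1:] ^ n * jacobi_poly J k)) \<le> (3 * M) ^ n"
proof (induction n arbitrary: k)
  case 0
  have "J n (Suc n) \<noteq> 0" for n
    using a by (simp add: J_def jacobi_matrix_def)
  then show ?case by (simp add: spectral_functional_jacobi_poly)
next
  case (Suc n)
  have nz: "J n (Suc n) \<noteq> 0" for n
    using a by (simp add: J_def jacobi_matrix_def)
  define p where "p = jacobi_poly J"
  \<comment> \<open>\<open>T\<close> keeps \<open>n\<close> of the \<open>Suc n\<close> factors,
    leaving one to be expanded by the recurrence; the induction hypothesis then bounds
    \<open>T\<close> on every \<open>p j\<close>.\<close>
  define T where "T u = spectral_functional J ([:0, 1:] ^ n * u)" for u
  have T_add: "T (u + v) = T u + T v" and T_smult: "T (smult c u) = c * T u" for u v c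
    using spectral_functional_linear[of J] nz
    by (simp_all add: T_def distrib_left Vector_Spaces.linear_iff del: mult_pCons_left)
  have T_p: "norm (T (p j)) \<le> (3 * M) ^ n" for j
    using Suc.IH by (simp add: T_def p_def)
  have M: "M \<ge> 0" using aM[of 0] norm_ge_zero order_trans by blast
  have bound: "norm (c * T (p j)) \<le> M * (3 * M) ^ n" if "norm c \<le> M" for c j
    using that T_p[of j] M by (simp add: norm_mult mult_mono)
  have "spectral_functional J ([:0, 1:] ^ Suc n * p k) = T ([:0, 1:] * p k)"
    by (simp add: T_def mult.assoc mult.left_commute del: mult_pCons_left mult_pCons_right)
  moreover have "norm (T ([:0, 1:] * p k)) \<le> 3 * (M * (3 * M) ^ n)"
  proof (cases k)
    case 0
    have "norm (T ([:0, 1:] * p k)) \<le> norm (b 0 * T (p 0)) + norm (a 0 * T (p 1))"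
      unfolding 0 p_def J_def jacobi_poly_times_x(1)[of a b, OF a] T_add T_smult
      by (rule norm_triangle_ineq)
    also have "\<dots> \<le> M * (3 * M) ^ n + M * (3 * M) ^ n"
      by (intro add_mono bound aM bM)
    also have "\<dots> \<le> 3 * (M * (3 * M) ^ n)"
      using M by simp
    finally show ?thesis .
  next
    case (Suc j)
    have "norm (T ([:0, 1:] * p k))
        \<le> norm (a j * T (p j)) + norm (b (Suc j) * T (p (Suc j)))
          + norm (a (Suc j) * T (p (Suc (Suc j))))"
      unfolding Suc p_def J_def jacobi_poly_times_x(2)[of a b, OF a] T_add T_smult
      by (intro norm_triangle_le add_right_mono norm_triangle_ineq)
    also have "\<dots> \<le> M * (3 * M) ^ n + M * (3 * M) ^ n + M * (3 * M) ^ n"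
      by (intro add_mono bound aM bM)
    finally show ?thesis by linarith
  qed
  moreover have "(3 * M) ^ Suc n = 3 * (M * (3 * M) ^ n)" by simp
  ultimately show ?case by (simp only: p_def)
qed

section \<open>Fourier integrals over one period\<close>

lemma has_bochner_integral_cis:
  "has_bochner_integral lborel (\<lambda>t. indicator {0..2 * pi} t *\<^sub>R cis (of_int k * t))
     (if k = 0 then 2 * pi else 0)"
proof (cases "k = 0")
  case True
  have "has_bochner_integral lborel (\<lambda>t. indicator {0..2 * pi} t *\<^sub>R (1::complex))
    (complex_of_real (2 * pi) - complex_of_real 0)"
    by (rule has_bochner_integral_FTC_Icc) (auto intro!: derivative_eq_intros)
  then show ?thesis using True by simp
next
  case False
  define F where "F t = cis (of_int k * t) / (\<i> * of_int k)" for t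
  have "has_bochner_integral lborel (\<lambda>t. indicator {0..2 * pi} t *\<^sub>R cis (of_int k * t))
      (F (2 * pi) - F 0)"
  proof (rule has_bochner_integral_FTC_Icc)
    show "(F has_vector_derivative cis (of_int k * x)) (at x within {0..2 * pi})" for x
      unfolding F_def has_vector_derivative_def using False
      by (auto intro!: derivative_eq_intros simp: scaleR_conv_of_real mult.left_commute[of "of_real h" \<i> for h])
  qed (auto intro!: continuous_intros)
  moreover have "cis (of_int k * (2 * pi)) = 1"
    using cis_multiple_2pi[of "of_int k"] by (simp add: mult.commute)
  ultimately show ?thesis using False by (simp add: F_def)
qed

text \<open>For \<open>n = m = 0\<close> both exponentials in the real part contribute, which compensates the missing
  factor \<open>2\<close> in the zeroth coefficient of the density.\<close>
lemma has_bochner_integral_cis_Re: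
  fixes d :: complex and m n :: nat
  shows
  "has_bochner_integral lborel
     (\<lambda>t. indicator {0..2 * pi} t *\<^sub>R (of_real (Re (d * cis (- (real n * t)))) * cis (real m * t)))
     (if n = m then if m = 0 then 2 * pi * Re d else pi * d else 0)"
proof -
  \<comment> \<open>Writing the real part as half the sum with the conjugate leaves the frequencies
    \<open>m - n\<close> and \<open>m + n\<close>; the latter is zero only for
    \<open>m = n = 0\<close>.\<close>
  have eq: "of_real (Re (d * cis (- (real n * t)))) * cis (real m * t)
      = d / 2 * cis (of_int (int m - int n) * t) + cnj d / 2 * cis (of_int (int m + int n) * t)" for t
  proof -
    have "complex_of_real (Re (d * cis (- (real n * t))))
        = (d * cis (- (real n * t)) + cnj d * cis (real n * t)) / 2"
      by (intro complex_eqI) simp_all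
    then show ?thesis
      by (simp add: algebra_simps cis_mult add_divide_distrib)
  qed
  have "has_bochner_integral lborel
     (\<lambda>t. d / 2 * (indicator {0..2 * pi} t *\<^sub>R cis (of_int (int m - int n) * t))
        + cnj d / 2 * (indicator {0..2 * pi} t *\<^sub>R cis (of_int (int m + int n) * t)))
     (d / 2 * (if int m - int n = 0 then 2 * pi else 0)
        + cnj d / 2 * (if int m + int n = 0 then 2 * pi else 0))"
    by (intro has_bochner_integral_add has_bochner_integral_mult_right has_bochner_integral_cis)
  also have "(d / 2 * (if int m - int n = 0 then 2 * pi else 0)
        + cnj d / 2 * (if int m + int n = 0 then 2 * pi else 0))
      = (if n = m then if m = 0 then 2 * pi * Re d else pi * d else 0)"
    by (auto simp: complex_eq_iff)
  finally show ?thesis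
    unfolding eq by (simp add: algebra_simps)
qed

section \<open>A measure on a circle with prescribed moments\<close>

lemma moment_measure_exists:
  fixes s :: "nat \<Rightarrow> complex"
  assumes s0: "s 0 = 1" and C: "C > 0" and s: "\<And>n. norm (s n) \<le> C ^ n"
  shows "\<exists>\<mu>. sets \<mu> = sets borel \<and> compact (measure_support \<mu>) \<and>
    (\<forall>n. has_bochner_integral \<mu> (\<lambda>z. z ^ n) (s n))"
proof -
  \<comment> \<open>The ratio 3 is chosen so that the non-constant terms of the density total at
    most \<open>2 * (1/3 + 1/9 + ...) = 1\<close>, which the constant term 1 just balances.\<close>
  define R where "R = 3 * C"
  have R: "R > 0" using C by (simp add: R_def)
  define d where "d n = (if n = 0 then 1 else 2 * s n / of_real R ^ n)" for n
  have d_le: "norm (d n) \<le> 2 * (1 / 3) ^ n" for n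
  proof (cases "n = 0")
    case False
    have "norm (d n) \<le> 2 * C ^ n / R ^ n"
      using False R s[of n] by (simp add: d_def norm_divide norm_mult norm_power divide_right_mono)
    also have "\<dots> = 2 * (1 / 3) ^ n"
      using C by (simp add: R_def power_mult_distrib power_divide)
    finally show ?thesis .
  qed (simp add: d_def)
  define u where "u n t = Re (d n * cis (- (real n * t)))" for n t
  have u_le: "\<bar>u n t\<bar> \<le> 2 * (1 / 3) ^ n" for n t
    unfolding u_def using abs_Re_le_cmod[of "d n * cis (- (real n * t))"] d_le[of n]
    by (simp add: norm_mult)
  have geo: "summable (\<lambda>n. 2 * (1 / 3 :: real) ^ n)"
    by (intro summable_mult summable_geometric) simp
  have u_summable: "summable (\<lambda>n. \<bar>u n t\<bar>)" for t
    by (rule summable_comparison_test'[OF geo]) (use u_le in auto)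
  define f where "f t = (\<Sum>n. u n t)" for t
  have f_nonneg: "f t \<ge> 0" for t
  proof -
    have g: "(\<lambda>n. 2 * (1 / 3 :: real) ^ Suc n) sums 1"
      using sums_mult[OF geometric_sums[of "1 / 3 :: real"], of "2 / 3"] by simp
    have su: "summable (\<lambda>n. \<bar>u (Suc n) t\<bar>)"
      using u_summable by (subst summable_Suc_iff)
    have "\<bar>\<Sum>n. u (Suc n) t\<bar> \<le> (\<Sum>n. \<bar>u (Suc n) t\<bar>)"
      using su by (rule summable_rabs)
    also have "\<dots> \<le> (\<Sum>n. 2 * (1 / 3) ^ Suc n)"
      by (rule suminf_le[OF u_le su sums_summable[OF g]])
    finally have "\<bar>\<Sum>n. u (Suc n) t\<bar> \<le> 1"
      using sums_unique[OF g] by simp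
    moreover have "f t = u 0 t + (\<Sum>n. u (Suc n) t)"
      using suminf_split_head[OF summable_rabs_cancel[OF u_summable], of t] by (simp add: f_def)
    moreover have "u 0 t = 1" by (simp add: u_def d_def)
    ultimately show ?thesis by linarith
  qed
  have u_meas[measurable]: "u n \<in> borel_measurable borel" for n
    unfolding u_def by (intro borel_measurable_continuous_onI continuous_intros)
  have f_meas[measurable]: "f \<in> borel_measurable borel"
    unfolding f_def by measurable
  define h where "h t = indicator {0..2 * pi} t * (f t / (2 * pi))" for t
  have h_meas[measurable]: "h \<in> borel_measurable borel"
    unfolding h_def by measurable
  have h_nonneg: "h t \<ge> 0" for t
    using f_nonneg by (simp add: h_def)
  define c where "c t = of_real R * cis t" for t
  have c_meas[measurable]: "c \<in> borel_measurable borel"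
    unfolding c_def by (intro borel_measurable_continuous_onI continuous_intros)
  define \<mu> where "\<mu> = distr (density lborel (\<lambda>t. ennreal (h t))) borel c"

  have "has_bochner_integral \<mu> (\<lambda>z. z ^ m) (s m)" for m
  proof -
    define v where "v n t = indicator {0..2 * pi} t *\<^sub>R (of_real (u n t) * cis (real m * t))" for n t
    \<comment> \<open>One formula covers both cases of the Fourier integral: \<open>pi * d m\<close>
      for \<open>m > 0\<close>, and \<open>2 * pi * Re (d 0)\<close> for \<open>m = 0\<close>
      because \<open>s 0 = 1\<close>.\<close>
    define I where "I n = (if n = m then 2 * pi * (s m / of_real R ^ m) else 0)" for n
    have v_int: "has_bochner_integral lborel (v n) (I n)" for n
    proof -
      have I_eq: "I n = (if n = m then if m = 0 then 2 * pi * Re (d n) else pi * d n else 0)"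
        using s0 by (simp add: I_def d_def)
      show ?thesis
        unfolding v_def[abs_def] u_def I_eq by (rule has_bochner_integral_cis_Re)
    qed
    have v_norm: "norm (v n t) = indicator {0..2 * pi} t * \<bar>u n t\<bar>" for n t
      by (simp add: v_def norm_mult)
    \<comment> \<open>Geometric decay of these norms is what permits integrating the series term by
      term.\<close>
    have v_le: "(\<integral>t. norm (v n t) \<partial>lborel) \<le> 2 * pi * (2 * (1 / 3) ^ n)" for n
    proof -
      have "(\<integral>t. norm (v n t) \<partial>lborel)
          \<le> (\<integral>t. indicator {0..2 * pi} t * (2 * (1 / 3) ^ n) \<partial>lborel)"
      proof (rule integral_mono)
        show "integrable lborel (\<lambda>t. norm (v n t))"
          using v_int by (intro integrable_norm) (auto simp: has_bochner_integral_iff)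
        show "norm (v n t) \<le> indicator {0..2 * pi} t * (2 * (1 / 3) ^ n)" for t
          using u_le by (simp add: v_norm mult_left_mono)
      qed simp
      then show ?thesis by simp
    qed
    have v_summable: "summable (\<lambda>n. norm (v n t))" for t
      unfolding v_norm by (intro summable_mult u_summable)
    have v_summable': "summable (\<lambda>n. \<integral>t. norm (v n t) \<partial>lborel)"
      by (rule summable_comparison_test'[OF summable_mult[OF geo, of "2 * pi"]])
        (use v_le in auto)
    have v_integrable: "integrable lborel (v n)" for n
      using v_int by (auto simp: has_bochner_integral_iff)
    have sum_eq: "(\<Sum>n. v n t) = (2 * pi) *\<^sub>R (h t *\<^sub>R cis (real m * t))" for t
    proof -
      have "(\<lambda>n. u n t) sums f t"
        unfolding f_def by (rule summable_sums[OF summable_rabs_cancel[OF u_summable]])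
      then have "(\<lambda>n. v n t) sums (indicator {0..2 * pi} t *\<^sub>R (of_real (f t) * cis (real m * t)))"
        unfolding v_def by (intro sums_scaleR_right sums_mult2 sums_of_real)
      then show ?thesis
        by (simp add: sums_iff h_def scaleR_conv_of_real)
    qed
    have "(\<lambda>n. I n) sums (2 * pi * (s m / of_real R ^ m))"
      unfolding I_def using sums_single[of m "\<lambda>_. 2 * pi * (s m / of_real R ^ m)"] by simp
    moreover have "I n = (\<integral>t. v n t \<partial>lborel)" for n
      using v_int has_bochner_integral_integral_eq by metis
    ultimately have "(\<integral>t. (\<Sum>n. v n t) \<partial>lborel) = 2 * pi * (s m / of_real R ^ m)"
      using integral_suminf[OF v_integrable] v_summable v_summable' by (simp add: sums_iff)
    then have "has_bochner_integral lborel (\<lambda>t. \<Sum>n. v n t) (2 * pi * (s m / of_real R ^ m))"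
      using integrable_suminf[OF v_integrable] v_summable v_summable'
      by (simp add: has_bochner_integral_iff)
    \<comment> \<open>The factor cancels \<open>2 * pi\<close> and turns
      \<open>cis (real m * t)\<close> into the power \<open>c t ^ m\<close> of a point on the circle
      of radius \<open>R\<close>.\<close>
    then have "has_bochner_integral lborel
        (\<lambda>t. of_real (R ^ m / (2 * pi)) * ((2 * pi) *\<^sub>R (h t *\<^sub>R cis (real m * t))))
        (of_real (R ^ m / (2 * pi)) * (2 * pi * (s m / of_real R ^ m)))"
      unfolding sum_eq by (rule has_bochner_integral_mult_right)
    moreover have "of_real (R ^ m / (2 * pi)) * ((2 * pi) *\<^sub>R (h t *\<^sub>R cis (real m * t)))
        = h t *\<^sub>R (c t ^ m)" for t
      by (simp add: c_def power_mult_distrib Complex.DeMoivre scaleR_conv_of_real)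
    moreover have "of_real (R ^ m / (2 * pi)) * (2 * pi * (s m / of_real R ^ m)) = s m"
      using R by simp
    ultimately have "has_bochner_integral lborel (\<lambda>t. h t *\<^sub>R (c t ^ m)) (s m)"
      by simp
    then have "has_bochner_integral (density lborel (\<lambda>t. ennreal (h t))) (\<lambda>t. c t ^ m) (s m)"
      using h_nonneg by (intro has_bochner_integral_density) auto
    then show ?thesis
      unfolding \<mu>_def by (intro has_bochner_integral_distr) auto
  qed
  moreover have sets: "sets \<mu> = sets borel" by (simp add: \<mu>_def)
  moreover have "compact (measure_support \<mu>)"
  proof -
    \<comment> \<open>All values of \<open>c\<close> have norm \<open>R\<close>, so the pushforward
      has no mass outside this disc.\<close>
    have "c -` (- cball 0 R) = {}"
      using R by (auto simp: c_def norm_mult)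
    then have "emeasure \<mu> (- cball 0 R) = 0"
      unfolding \<mu>_def by (subst emeasure_distr) auto
    then show ?thesis
      using compact_measure_support_iff[OF sets] compact_cball by blast
  qed
  ultimately show ?thesis by blast
qed

section \<open>From monomials to all polynomials\<close>

theorem corollary1:
  fixes a b :: "nat \<Rightarrow> complex" and M :: real
  assumes "\<And>k. a k \<noteq> 0"
    and "M > 0"
    and "\<And>k. norm (a k) \<le> M"
    and "\<And>k. norm (b k) \<le> M"
  shows "\<exists>\<mu> :: complex measure.
           sets \<mu> = sets borel \<and>
           compact (measure_support \<mu>) \<and>
           (\<forall>p :: complex poly.
              integrable \<mu> (\<lambda>z. poly p z) \<and>
              spectral_functional (jacobi_matrix a b) p = (\<integral>z. poly p z \<partial>\<mu>))"
proof -
  define J where "J = jacobi_matrix a b"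
  define S where "S = spectral_functional J"
  have nz: "J n (Suc n) \<noteq> 0" for n
    using assms(1) by (simp add: J_def jacobi_matrix_def)
  have lin: "Vector_Spaces.linear smult (*) S"
    unfolding S_def using nz by (rule spectral_functional_linear)
  have s0: "S (monom 1 0) = 1"
    using spectral_functional_jacobi_poly[of J 0] nz by (simp add: S_def flip: one_pCons)
  \<comment> \<open>The zeroth orthonormal polynomial is 1, so the case \<open>k = 0\<close> of the
    general bound is about pure powers.\<close>
  have s_le: "norm (S (monom 1 n)) \<le> (3 * M) ^ n" for n
    using norm_spectral_functional_le[of a M b n 0] assms
    by (simp add: S_def J_def monom_altdef)
  obtain \<mu> where \<mu>: "sets \<mu> = sets borel" "compact (measure_support \<mu>)"
    and moments: "\<And>n. has_bochner_integral \<mu> (\<lambda>z. z ^ n) (S (monom 1 n))"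
    using moment_measure_exists[of "\<lambda>n. S (monom 1 n)" "3 * M"] s0 s_le assms(2) by auto
  \<comment> \<open>Both sides are linear in \<open>p\<close>, so the moments suffice;
    \<open>has_bochner_integral\<close> carries integrability along with the value.\<close>
  have "has_bochner_integral \<mu> (poly p) (S p)" for p
  proof -
    have "has_bochner_integral \<mu> (\<lambda>z. \<Sum>i\<le>degree p. coeff p i * z ^ i)
        (\<Sum>i\<le>degree p. coeff p i * S (monom 1 i))"
      by (intro has_bochner_integral_sum has_bochner_integral_mult_right moments)
    moreover have "S p = (\<Sum>i\<le>degree p. coeff p i * S (monom 1 i))"
    proof -
      have "S p = S (\<Sum>i\<le>degree p. smult (coeff p i) (monom 1 i))"
        by (simp add: smult_monom poly_as_sum_of_monoms)
      also have "\<dots> = (\<Sum>i\<le>degree p. S (smult (coeff p i) (monom 1 i)))"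
        by (rule module_hom.sum[OF lin[unfolded linear_iff_module_hom]])
      finally show ?thesis
        using lin by (simp add: Vector_Spaces.linear_iff)
    qed
    ultimately show ?thesis by (simp add: poly_altdef[abs_def])
  qed
  then show ?thesis
    using \<mu> unfolding has_bochner_integral_iff S_def J_def by metis
qed

end
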